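(* Let $\{\sigma_n\}_{n\in\mathbb{N}}\subset[0,1)$ and let $\{r_n\}_{n\in\mathbb{N}}\subset(0,+\infty)$ with $r_n\to0^+$. Let $U\subset\mathbb{R}^d$ be an open bounded set and let $\{E_n\}_{n\in\mathbb{N}}\subset\mathcal{M}_{\mathrm f}(\mathbb{R}^d)$ be such that $E_n\subset U$ for all $n\in\mathbb{N}$. Let $C>0$. If $\hat J^{\sigma_n}_{r_n}(E_n)\le C$ for all $n\in\mathbb{N}$, then, up to a subsequence, $\chi_{E_n}\to\chi_E$ in $L^1(\mathbb{R}^d)$ for some $E\in\mathcal{M}_{\mathrm f}(\mathbb{R}^d)$. In particular, if $\hat J^{\sigma_n}(E_n)\le C$ for all $n\in\mathbb{N}$, then, up to a subsequence, $\chi_{E_n}\to\chi_E$ in $L^1(\mathbb{R}^d)$ for some $E\in\mathcal{M}_{\mathrm f}(\mathbb{R}^d)$.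
   Context: Let $d\ge1$, let $|E|$ denote Lebesgue measure in $\mathbb{R}^d$, $\omega_d$ the measure of the unit ball, $B_\rho(x)$ the ball of radius $\rho$ and center $x$, and $\chi_E$ the characteristic function of $E$. $\mathcal{M}_{\mathrm f}(\mathbb{R}^d)$ is the family of measurable sets $E\subset\mathbb{R}^d$ with $|E|<+\infty$. For $\sigma\in(-d,1)$ and $r>0$ set $$\gamma^\sigma_r:=d\omega_d\frac{1-r^{-\sigma}}{\sigma}\ \text{ if }\sigma\ne0,\qquad \gamma^0_r:=d\omega_d\log r,$$ $$\hat J^\sigma_r(E):=-\int_E\int_{E\setminus B_r(x)}\frac{1}{|x-y|^{d+\sigma}}\,dy\,dx-\gamma^\sigma_r|E|,\qquad E\in\mathcal{M}_{\mathrm f}(\mathbb{R}^d).$$ For $\sigma\in[0,1)$, $\hat J^\sigma(E):=\lim_{r\to0^+}\hat J^\sigma_r(E)\in(-\infty,+\infty]$ (the limit exists because $r\mapsto\hat J^\sigma_r(E)$ is non-increasing). *)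

theory Defs
  imports "HOL-Analysis.Analysis"
begin

text \<open>
  Throughout, \<open>\<real>\<^sup>d\<close> is an arbitrary Euclidean space \<open>'a\<close> with \<open>d = DIM('a)\<close> (so \<open>d \<ge> 1\<close>), and
  the finite-measure Lebesgue measurable sets are \<open>lmeasurable\<close>.
\<close>

definition gamma_const :: "'a::euclidean_space itself \<Rightarrow> real \<Rightarrow> real \<Rightarrow> real" where
  "gamma_const _ \<sigma> r =
     (if \<sigma> = 0 then real DIM('a) * measure lebesgue (ball (0::'a) 1) * ln r
      else real DIM('a) * measure lebesgue (ball (0::'a) 1) * ((1 - r powr (-\<sigma>)) / \<sigma>))"

text \<open>
  Used for \<open>-d < \<sigma> < 1\<close>, \<open>r > 0\<close> and \<open>E \<in> lmeasurable\<close>. There the kernel is bounded by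
  \<open>r powr (-(d + \<sigma>))\<close> off the ball, so both Bochner integrals are of integrable functions.
\<close>
definition Jhat_r :: "real \<Rightarrow> real \<Rightarrow> 'a::euclidean_space set \<Rightarrow> real" where
  "Jhat_r \<sigma> r E =
     - (LINT x:E|lebesgue. (LINT y:(E - ball x r)|lebesgue.
          1 / norm (x - y) powr (real DIM('a) + \<sigma>)))
     - gamma_const TYPE('a) \<sigma> r * measure lebesgue E"

text \<open>
  Used for \<open>0 \<le> \<sigma> < 1\<close> and \<open>E \<in> lmeasurable\<close>. The limit is taken in the extended reals, where it
  exists because \<open>r \<mapsto> Jhat_r \<sigma> r E\<close> is non-increasing on the positive reals.
\<close>
definition Jhat :: "real \<Rightarrow> 'a::euclidean_space set \<Rightarrow> ereal" where
  "Jhat \<sigma> E = Lim (at_right 0) (\<lambda>r. ereal (Jhat_r \<sigma> r E))"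

end

theory Submission
  imports Defs "HOL-Complex_Analysis.Great_Picard"
begin

text \<open>
  Since \<open>- gamma_const \<sigma> r\<close> is the integral of \<open>|h| powr - (d + \<sigma>)\<close> over the annulus \<open>r \<le> |h| < 1\<close>,
  the functional \<open>Jhat_r \<sigma> r E\<close> is, up to an error of at most \<open>|E|\<^sup>2\<close>, the interaction of \<open>E\<close> with its
  complement through the kernel restricted to that annulus. On the annulus the kernel dominates
  \<open>\<eta>\<^sub>\<delta> = |h| powr - d\<close> on \<open>\<delta> \<le> |h| < 1\<close> whenever \<open>r \<le> \<delta>\<close> and \<open>\<sigma> \<ge> 0\<close>, so the bound \<open>Jhat_r \<le> C\<close>
  says that \<open>\<chi>\<^sub>E\<close> differs in \<open>L\<^sup>1\<close> from its average against \<open>\<eta>\<^sub>\<delta>\<close> by at most a constant over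
  the mass of \<open>\<eta>\<^sub>\<delta>\<close>, which grows like \<open>ln (1 / \<delta>)\<close>. For fixed \<open>\<delta>\<close> the averages are equicontinuous,
  so a diagonal subsequence makes them converge for all \<open>\<delta> = 1 / (k + 2)\<close>, and along
  this subsequence the sets are Cauchy in measure.
\<close>

section \<open>Convolution of a bounded kernel with a set\<close>

definition conv :: "('a::euclidean_space \<Rightarrow> real) \<Rightarrow> 'a set \<Rightarrow> 'a \<Rightarrow> real" where
  "conv k A x = (LINT y:A|lebesgue. k (x - y))"

text \<open>Balls of integer radius exhaust the space. Sigma-finiteness of the completed measure is
  what Fubini on its square requires below.\<close>

lemma sigma_finite_lebesgue: "sigma_finite_measure (lebesgue :: 'a::euclidean_space measure)"
proof
  show "\<exists>A. countable A \<and> A \<subseteq> sets lebesgue \<and> \<Union> A = space lebesgue \<and>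
      (\<forall>a\<in>A. emeasure lebesgue (a :: 'a set) \<noteq> \<infinity>)"
  proof (intro exI conjI)
    show "\<Union> (range (\<lambda>n::nat. ball (0::'a) (real n))) = space lebesgue"
      by (auto simp: reals_Archimedean2)
  qed (use lmeasurable_ball emeasure_lborel_ball_finite in \<open>auto simp: less_top\<close>)
qed

interpretation lebesgue: sigma_finite_measure "lebesgue :: 'a::euclidean_space measure"
  by (rule sigma_finite_lebesgue)

interpretation lebesgue_pair: pair_sigma_finite
  "lebesgue :: 'a::euclidean_space measure" "lebesgue :: 'b::euclidean_space measure" ..

text \<open>The difference map on the product is shown to be measurable into the Borel sets; hence
  the kernels are taken Borel rather than Lebesgue measurable.\<close>

lemma measurable_kernel [measurable]:
  fixes k :: "'a::euclidean_space \<Rightarrow> real"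
  assumes "k \<in> borel_measurable borel"
  shows "(\<lambda>(x, y). k (x - y)) \<in> borel_measurable (lebesgue \<Otimes>\<^sub>M lebesgue)"
proof -
  have "(\<lambda>x::'a. x) \<in> lebesgue \<rightarrow>\<^sub>M borel"
    by (intro measurable_completion) simp
  have "(\<lambda>p::'a\<times>'a. fst p) \<in> lebesgue \<Otimes>\<^sub>M lebesgue \<rightarrow>\<^sub>M borel"
       "(\<lambda>p::'a\<times>'a. snd p) \<in> lebesgue \<Otimes>\<^sub>M lebesgue \<rightarrow>\<^sub>M borel"
    using measurable_compose[OF measurable_fst \<open>(\<lambda>x::'a. x) \<in> lebesgue \<rightarrow>\<^sub>M borel\<close>]
      measurable_compose[OF measurable_snd \<open>(\<lambda>x::'a. x) \<in> lebesgue \<rightarrow>\<^sub>M borel\<close>] by auto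
  then have "(\<lambda>p::'a\<times>'a. fst p - snd p) \<in> lebesgue \<Otimes>\<^sub>M lebesgue \<rightarrow>\<^sub>M borel"
    by (rule borel_measurable_diff)
  from measurable_compose[OF this assms] show ?thesis by (simp add: case_prod_beta')
qed

text \<open>Boundedness suffices for integrals over sets of finite measure. It suits
  \<open>|h| powr - (d + \<sigma>)\<close> cut off near the origin, whose integral over the whole
  space is infinite when \<open>\<sigma> = 0\<close>.\<close>

locale bounded_kernel =
  fixes k :: "'a::euclidean_space \<Rightarrow> real" and M :: real
  assumes kernel_measurable [measurable]: "k \<in> borel_measurable borel"
    and kernel_nonneg: "\<And>h. 0 \<le> k h"
    and kernel_le: "\<And>h. k h \<le> M"
begin

lemma bound_nonneg: "0 \<le> M"
  using kernel_nonneg[of 0] kernel_le[of 0] by linarith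

text \<open>Dominated by \<open>M\<close> times the indicator of the rectangle
  \<open>A \<times> B\<close>, which has finite measure.\<close>

lemma pair_integrable:
  assumes [measurable]: "A \<in> lmeasurable" "B \<in> lmeasurable"
  shows "integrable (lebesgue \<Otimes>\<^sub>M lebesgue)
           (\<lambda>(x, y). indicat_real A x * (indicat_real B y * k (x - y)))"
proof (rule Bochner_Integration.integrable_bound)
  have "A \<times> B \<in> sets (lebesgue \<Otimes>\<^sub>M lebesgue)" using assms by (intro pair_measureI) auto
  moreover have "emeasure (lebesgue \<Otimes>\<^sub>M lebesgue) (A \<times> B) = emeasure lebesgue A * emeasure lebesgue B"
    using assms by (intro lebesgue.emeasure_pair_measure_Times) auto
  then have "emeasure (lebesgue \<Otimes>\<^sub>M lebesgue) (A \<times> B) < \<infinity>"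
    using assms by (simp add: ennreal_mult_less_top fmeasurable_def)
  ultimately show "integrable (lebesgue \<Otimes>\<^sub>M lebesgue) (\<lambda>p. M * indicat_real (A \<times> B) p)"
    by (intro integrable_mult_right integrable_real_indicator) auto
  have [measurable]: "A \<in> sets lebesgue" "B \<in> sets lebesgue" using assms by auto
  show "(\<lambda>(x, y). indicat_real A x * (indicat_real B y * k (x - y)))
         \<in> borel_measurable (lebesgue \<Otimes>\<^sub>M lebesgue)"
    by measurable
  show "AE p in lebesgue \<Otimes>\<^sub>M lebesgue. norm (case p of (x, y) \<Rightarrow>
          indicat_real A x * (indicat_real B y * k (x - y))) \<le> norm (M * indicat_real (A \<times> B) p)"
    using kernel_nonneg kernel_le bound_nonneg by (intro AE_I2) (auto simp: indicator_times split: split_indicator)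
qed

lemma section_integrable:
  assumes "B \<in> lmeasurable"
  shows "set_integrable lebesgue B (\<lambda>y. k (x - y))"
  unfolding set_integrable_def
proof (rule Bochner_Integration.integrable_bound)
  show "integrable lebesgue (\<lambda>y. M * indicat_real B y)"
    using assms by (intro integrable_mult_right integrable_real_indicator) (auto simp: fmeasurable_def)
  have "(\<lambda>y. k (x - y)) \<in> borel_measurable borel" by measurable
  then have "(\<lambda>y. k (x - y)) \<in> borel_measurable lebesgue"
    by (simp add: measurable_completion)
  then show "(\<lambda>y. indicat_real B y *\<^sub>R k (x - y)) \<in> borel_measurable lebesgue"
    using assms by (intro borel_measurable_scaleR borel_measurable_indicator) auto
  show "AE y in lebesgue. norm (indicat_real B y *\<^sub>R k (x - y)) \<le> norm (M * indicat_real B y)"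
    using kernel_nonneg kernel_le bound_nonneg by (intro AE_I2) (auto split: split_indicator)
qed

lemma conv_nonneg: "0 \<le> conv k B x"
  unfolding conv_def set_lebesgue_integral_def
  by (intro integral_nonneg_AE AE_I2) (use kernel_nonneg in auto)

lemma conv_le_measure:
  assumes "B \<in> lmeasurable"
  shows "conv k B x \<le> M * measure lebesgue B"
proof -
  have "conv k B x \<le> (LINT y:B|lebesgue. M)"
    unfolding conv_def
    using assms kernel_le by (intro set_integral_mono section_integrable)
      (auto simp: fmeasurable_def)
  then show ?thesis using assms by (simp add: set_lebesgue_integral_def fmeasurableD mult.commute)
qed

lemma conv_union:
  assumes "A \<in> lmeasurable" "B \<in> lmeasurable" "A \<inter> B = {}"
  shows "conv k (A \<union> B) x = conv k A x + conv k B x"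
  unfolding conv_def using assms by (intro set_integral_Un section_integrable)

lemma conv_integrable:
  assumes "A \<in> lmeasurable" "B \<in> lmeasurable"
  shows "set_integrable lebesgue A (conv k B)"
  using lebesgue_pair.integrable_fst'[OF pair_integrable[OF assms]]
  by (simp add: set_integrable_def conv_def set_lebesgue_integral_def)

text \<open>Fubini, after which evenness turns \<open>k (x - y)\<close> into
  \<open>k (y - x)\<close>.\<close>

lemma conv_swap:
  assumes "A \<in> lmeasurable" "B \<in> lmeasurable" and even: "\<And>h. k (- h) = k h"
  shows "(LINT x:A|lebesgue. conv k B x) = (LINT x:B|lebesgue. conv k A x)"
proof -
  have "(LINT x:A|lebesgue. conv k B x) =
     (\<integral>x. (\<integral>y. indicat_real A x * (indicat_real B y * k (x - y)) \<partial>lebesgue) \<partial>lebesgue)"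
    by (simp add: conv_def set_lebesgue_integral_def)
  also have "\<dots> = (\<integral>y. (\<integral>x. indicat_real A x * (indicat_real B y * k (x - y)) \<partial>lebesgue) \<partial>lebesgue)"
    by (rule lebesgue_pair.Fubini_integral[OF pair_integrable[OF assms(1,2)], symmetric])
  also have "\<dots> = (\<integral>y. indicat_real B y * (\<integral>x. indicat_real A x * k (y - x) \<partial>lebesgue) \<partial>lebesgue)"
  proof (intro Bochner_Integration.integral_cong refl)
    fix y
    have "k (x - y) = k (y - x)" for x using even[of "x - y"] by simp
    then show "(\<integral>x. indicat_real A x * (indicat_real B y * k (x - y)) \<partial>lebesgue) =
       indicat_real B y * (\<integral>x. indicat_real A x * k (y - x) \<partial>lebesgue)"
      by (simp add: mult.left_commute[of "indicat_real A _"])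
  qed
  also have "\<dots> = (LINT x:B|lebesgue. conv k A x)"
    by (simp add: conv_def set_lebesgue_integral_def)
  finally show ?thesis .
qed

end

section \<open>Even kernels of finite mass\<close>

locale integrable_kernel = bounded_kernel +
  assumes kernel_even: "\<And>h. k (- h) = k h"
    and kernel_integrable: "integrable lborel k"
begin

lemma translate_integrable: "integrable lebesgue (\<lambda>y. k (x - y))"
  and translate_integral: "(LINT y|lebesgue. k (x - y)) = integral\<^sup>L lborel k"
proof -
  have eq: "k (x - y) = k (- x + y)" for y using kernel_even[of "x - y"] by simp
  have d: "distr lborel borel ((+) (- x)) = lborel" by (rule lborel_distr_plus)
  have "integrable lborel (\<lambda>y. k (- x + y))"
    using kernel_integrable by (subst (asm) d[symmetric], subst (asm) integrable_distr_eq) auto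
  then show "integrable lebesgue (\<lambda>y. k (x - y))"
    unfolding eq by (subst integrable_completion) auto
  have "(LINT y|lebesgue. k (- x + y)) = (LINT y|lborel. k (- x + y))"
    by (rule integral_completion) auto
  also have "\<dots> = integral\<^sup>L (distr lborel borel ((+) (- x))) k"
    by (rule integral_distr[symmetric]) auto
  finally show "(LINT y|lebesgue. k (x - y)) = integral\<^sup>L lborel k"
    unfolding eq d .
qed

text \<open>Nonnegativity lets the integral over \<open>B\<close> grow to the whole space, where
  translation invariance makes it independent of \<open>x\<close>. Hence the deficit, total mass
  minus \<open>conv k B\<close>, is nonnegative.\<close>

lemma conv_le_integral: 
  assumes "B \<in> sets lebesgue"
  shows "conv k B x \<le> integral\<^sup>L lborel k"
proof -
  have "conv k B x \<le> (LINT y|lebesgue. k (x - y))"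
    unfolding conv_def set_lebesgue_integral_def
    using kernel_nonneg translate_integrable assms
    by (intro integral_mono integrable_mult_indicator) (auto split: split_indicator)
  then show ?thesis by (simp add: translate_integral)
qed

end

section \<open>Radial integrals\<close>

text \<open>Polar coordinates as a pushforward. Both measures give the half-line
  \<open>{..<a}\<close> the volume of the ball of radius \<open>a\<close>, and half-lines are stable
  under intersection and generate the Borel sets.\<close>

lemma distr_norm_lborel:
  "distr lborel borel (norm :: 'a::euclidean_space \<Rightarrow> real) =
     density lborel (\<lambda>t. ennreal (real DIM('a) * measure lebesgue (ball (0::'a) 1) * t ^ (DIM('a) - 1))
       * indicator {0..} t)"
  (is "?D = density lborel ?f")
proof (rule measure_eqI_generator_eq)
  define w where "w = measure lebesgue (ball (0::'a) 1)"
  have w: "w = unit_ball_vol (real DIM('a))"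
    unfolding w_def by (simp add: content_ball measure_completion)
  have w0: "0 \<le> w" unfolding w_def by simp
  have dist: "emeasure ?D {..<a} = emeasure lborel (ball (0::'a) a)" for a
    by (subst emeasure_distr) (auto intro!: arg_cong[where f="emeasure lborel"])
  have "{..<a} \<inter> {..<b} = {..<min a b}" for a b :: real by auto
  then show "Int_stable (range (\<lambda>a::real. {..<a}))"
    by (auto simp: Int_stable_def)
  show "range (\<lambda>a::real. {..<a}) \<subseteq> Pow UNIV" by auto
  show "sets ?D = sigma_sets UNIV (range lessThan)"
    by (simp add: borel_Iio)
  show "sets (density lborel ?f) = sigma_sets UNIV (range lessThan)"
    by (simp add: borel_Iio)
  show "range (\<lambda>n::nat. {..<real n}) \<subseteq> range lessThan" by auto
  show "(\<Union>n::nat. {..<real n}) = UNIV" by (auto simp: reals_Archimedean2)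
  show "emeasure ?D {..<real n} \<noteq> \<infinity>" for n
    unfolding dist by (simp add: emeasure_ball)
  fix X :: "real set" assume "X \<in> range lessThan"
  then obtain a where X: "X = {..<a}" by auto
  have dens: "emeasure (density lborel ?f) {..<a} = (\<integral>\<^sup>+t. ?f t * indicator {..<a} t \<partial>lborel)"
    by (subst emeasure_density) auto
  show "emeasure ?D X = emeasure (density lborel ?f) X"
  proof (cases "0 < a")
    case True
    have "(\<integral>\<^sup>+t. ?f t * indicator {..<a} t \<partial>lborel) =
       (\<integral>\<^sup>+t. ennreal (real DIM('a) * w * t ^ (DIM('a) - 1)) * indicator {0..a} t \<partial>lborel)"
      using AE_lborel_singleton[of a] unfolding w_def
      by (intro nn_integral_cong_AE) (auto split: split_indicator)
    also have "\<dots> = ennreal (w * a ^ DIM('a) - w * 0 ^ DIM('a))"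
      using True w0 by (intro nn_integral_FTC_Icc) (auto intro!: derivative_eq_intros)
    also have "\<dots> = emeasure lborel (ball (0::'a) a)"
      using True by (simp add: emeasure_ball w)
    finally show ?thesis unfolding X dens dist ..
  next
    case False
    then have "(\<integral>\<^sup>+t. ?f t * indicator {..<a} t \<partial>lborel) = (\<integral>\<^sup>+t. 0 \<partial>(lborel :: real measure))"
      by (intro nn_integral_cong) (auto split: split_indicator)
    moreover have "emeasure lborel (ball (0::'a) a) = 0" using False by (subst ball_empty) auto
    ultimately show ?thesis unfolding X dens dist by simp
  qed
qed

text \<open>In polar coordinates, \<open>gamma_const\<close> is the primitive, vanishing at
  \<open>1\<close>, of the radial density of \<open>|h| powr - (d + \<sigma>)\<close>; for
  \<open>\<sigma> = 0\<close> this primitive is a logarithm.\<close>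

lemma gamma_const_deriv:
  assumes "0 < t"
  shows "(gamma_const TYPE('a::euclidean_space) \<sigma> has_real_derivative
     real DIM('a) * measure lebesgue (ball (0::'a) 1) * t powr (- \<sigma> - 1)) (at t)"
proof (cases "\<sigma> = 0")
  case True
  with assms show ?thesis
    unfolding gamma_const_def[abs_def]
    by (auto intro!: derivative_eq_intros simp: powr_minus_divide)
next
  case False
  with assms show ?thesis
    unfolding gamma_const_def[abs_def]
    by (auto intro!: derivative_eq_intros simp: field_simps)
qed

text \<open>The interval is half-open so that cutting at \<open>s\<close> splits the kernel
  truncated at \<open>r\<close> exactly into this one and the kernel truncated at
  \<open>s\<close>.\<close>

definition annular_kernel :: "real \<Rightarrow> real \<Rightarrow> real \<Rightarrow> 'a::euclidean_space \<Rightarrow> real" where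
  "annular_kernel \<sigma> r s h = indicat_real {r..<s} (norm h) / norm h powr (real DIM('a) + \<sigma>)"

lemma annular_kernel_measurable [measurable]: "annular_kernel \<sigma> r s \<in> borel_measurable borel"
  unfolding annular_kernel_def[abs_def]
  by (intro borel_measurable_divide powr_real_measurable borel_measurable_norm) measurable

text \<open>Pushing forward along the norm leaves the radial density on an interval, which the
  fundamental theorem of calculus integrates.\<close>

lemma annular_kernel_integral:
  assumes "0 < r" "r \<le> s"
  shows "has_bochner_integral lborel (annular_kernel \<sigma> r s :: 'a::euclidean_space \<Rightarrow> real)
    (gamma_const TYPE('a) \<sigma> s - gamma_const TYPE('a) \<sigma> r)"
proof (rule has_bochner_integral_nn_integral)
  define w where "w = measure lebesgue (ball (0::'a) 1)"
  have w0: "0 \<le> w" unfolding w_def by simp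
  let ?g = "\<lambda>t::real. ennreal (indicat_real {r..<s} t / t powr (real DIM('a) + \<sigma>))"
  let ?f = "\<lambda>t::real. ennreal (real DIM('a) * w * t ^ (DIM('a) - 1)) * indicator {0..} t"
  have mono: "gamma_const TYPE('a) \<sigma> r \<le> gamma_const TYPE('a) \<sigma> s"
  proof (rule DERIV_nonneg_imp_nondecreasing[OF assms(2)])
    fix t assume "r \<le> t" "t \<le> s"
    then show "\<exists>y. (gamma_const TYPE('a) \<sigma> has_real_derivative y) (at t) \<and> 0 \<le> y"
      using assms(1) w0 gamma_const_deriv[of t, where 'a='a and \<sigma>=\<sigma>]
      by (intro exI[of _ "real DIM('a) * w * t powr (- \<sigma> - 1)"]) (auto simp: w_def)
  qed
  show "0 \<le> gamma_const TYPE('a) \<sigma> s - gamma_const TYPE('a) \<sigma> r" using mono by simp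
  show "(annular_kernel \<sigma> r s :: 'a \<Rightarrow> real) \<in> borel_measurable lborel" by simp
  show "AE h in lborel. 0 \<le> annular_kernel \<sigma> r s (h::'a)"
    by (simp add: annular_kernel_def)
  have "(\<integral>\<^sup>+h. ennreal (annular_kernel \<sigma> r s (h::'a)) \<partial>lborel) =
     (\<integral>\<^sup>+h. ?g (norm (h::'a)) \<partial>lborel)"
    by (intro nn_integral_cong) (auto simp: annular_kernel_def split: split_indicator)
  also have "\<dots> = (\<integral>\<^sup>+t. ?g t \<partial>distr lborel borel (norm :: 'a \<Rightarrow> real))"
    by (rule nn_integral_distr[symmetric]) auto
  also have "\<dots> = (\<integral>\<^sup>+t. ?f t * ?g t \<partial>lborel)"
    unfolding distr_norm_lborel w_def by (rule nn_integral_density) auto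
  \<comment> \<open>The fundamental theorem is applied on the closed interval \<open>{r..s}\<close>;
    the extra endpoint \<open>s\<close> is a null set.\<close>
  also have "\<dots> = (\<integral>\<^sup>+t. ennreal (real DIM('a) * w * t powr (- \<sigma> - 1)) * indicator {r..s} t \<partial>lborel)"
    using AE_lborel_singleton[of s]
  proof (intro nn_integral_cong_AE, eventually_elim)
    case (elim t)
    show ?case
    proof (cases "t \<in> {r..<s}")
      case True
      then have t: "0 < t" using assms by auto
      have "t ^ (DIM('a) - 1) = t powr (real DIM('a) - 1)"
        using t by (simp add: powr_realpow[symmetric] of_nat_diff)
      then have "t ^ (DIM('a) - 1) / t powr (real DIM('a) + \<sigma>) = t powr (- \<sigma> - 1)"
        by (simp add: powr_diff[symmetric] minus_diff_commute)
      then have "real DIM('a) * w * t ^ (DIM('a) - 1) * (1 / t powr (real DIM('a) + \<sigma>))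
          = real DIM('a) * w * t powr (- \<sigma> - 1)" by (metis mult.assoc mult.right_neutral times_divide_eq_right)
      then show ?thesis using True t w0 by (simp add: ennreal_mult[symmetric])
    qed (use elim in \<open>auto split: split_indicator\<close>)
  qed
  also have "\<dots> = ennreal (gamma_const TYPE('a) \<sigma> s - gamma_const TYPE('a) \<sigma> r)"
    using assms w0 unfolding w_def
    by (intro nn_integral_FTC_Icc gamma_const_deriv) auto
  finally show "(\<integral>\<^sup>+h. ennreal (annular_kernel \<sigma> r s (h::'a)) \<partial>lborel) =
     ennreal (gamma_const TYPE('a) \<sigma> s - gamma_const TYPE('a) \<sigma> r)" .
qed

section \<open>The truncated functionals\<close>

text \<open>The closed half-line matches the removal of an open ball in
  \<open>Jhat_r\<close>.\<close>

definition truncated_kernel :: "real \<Rightarrow> real \<Rightarrow> 'a::euclidean_space \<Rightarrow> real" where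
  "truncated_kernel \<sigma> r h = indicat_real {r..} (norm h) / norm h powr (real DIM('a) + \<sigma>)"

lemma truncated_kernel_bounded:
  assumes "0 < r" "0 \<le> \<sigma>"
  shows "bounded_kernel (truncated_kernel \<sigma> r :: 'a::euclidean_space \<Rightarrow> real)
    (1 / r powr (real DIM('a) + \<sigma>))"
proof
  show "(truncated_kernel \<sigma> r :: 'a \<Rightarrow> real) \<in> borel_measurable borel"
    unfolding truncated_kernel_def[abs_def]
    by (intro borel_measurable_divide powr_real_measurable borel_measurable_norm) measurable
  show "0 \<le> truncated_kernel \<sigma> r (h::'a)" for h by (simp add: truncated_kernel_def)
  show "truncated_kernel \<sigma> r (h::'a) \<le> 1 / r powr (real DIM('a) + \<sigma>)" for h
    using assms by (auto simp: truncated_kernel_def zero_less_mult_iff split: split_indicator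
        intro!: divide_left_mono powr_mono2)
qed

lemma annular_kernel_integrable:
  assumes "0 < r" "r \<le> s" "0 \<le> \<sigma>"
  shows "integrable_kernel (annular_kernel \<sigma> r s :: 'a::euclidean_space \<Rightarrow> real)
    (1 / r powr (real DIM('a) + \<sigma>))"
proof
  show "0 \<le> annular_kernel \<sigma> r s (h::'a)" for h by (simp add: annular_kernel_def)
  show "annular_kernel \<sigma> r s (h::'a) \<le> 1 / r powr (real DIM('a) + \<sigma>)" for h
    using assms by (auto simp: annular_kernel_def zero_less_mult_iff split: split_indicator
        intro!: divide_left_mono powr_mono2)
  show "annular_kernel \<sigma> r s (- h) = annular_kernel \<sigma> r s (h::'a)" for h
    by (simp add: annular_kernel_def)
  show "integrable lborel (annular_kernel \<sigma> r s :: 'a \<Rightarrow> real)"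
    using annular_kernel_integral[OF assms(1,2), where 'a='a] by (rule integrable.intros)
qed (rule annular_kernel_measurable)

lemma integral_annular_kernel:
  assumes "0 < r" "r \<le> s"
  shows "integral\<^sup>L lborel (annular_kernel \<sigma> r s :: 'a::euclidean_space \<Rightarrow> real) =
    gamma_const TYPE('a) \<sigma> s - gamma_const TYPE('a) \<sigma> r"
  using annular_kernel_integral[OF assms] by (rule has_bochner_integral_integral_eq)

lemma Jhat_r_eq_conv:
  "Jhat_r \<sigma> r (E :: 'a::euclidean_space set) =
    - (LINT x:E|lebesgue. conv (truncated_kernel \<sigma> r) E x)
    - gamma_const TYPE('a) \<sigma> r * measure lebesgue E"
proof -
  have "(LINT y:(E - ball x r)|lebesgue. 1 / norm (x - y) powr (real DIM('a) + \<sigma>))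
      = conv (truncated_kernel \<sigma> r) E x" for x
    unfolding conv_def set_lebesgue_integral_def truncated_kernel_def
    by (intro Bochner_Integration.integral_cong) (auto simp: dist_norm split: split_indicator)
  then show ?thesis by (simp add: Jhat_r_def)
qed

text \<open>Lowering the cutoff from \<open>s\<close> to \<open>r\<close> adds the annulus
  \<open>r \<le> |h| < s\<close> to the kernel and changes \<open>gamma_const\<close> by the mass of
  that annulus. The integrand is thus the interaction of a point of \<open>E\<close> with the
  complement of \<open>E\<close> through the annulus.\<close>

lemma Jhat_r_diff:
  assumes "0 < r" "r \<le> s" "0 \<le> \<sigma>" and E: "E \<in> lmeasurable"
  shows "Jhat_r \<sigma> r E - Jhat_r \<sigma> s (E :: 'a::euclidean_space set) =
    (LINT x:E|lebesgue. gamma_const TYPE('a) \<sigma> s - gamma_const TYPE('a) \<sigma> r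
       - conv (annular_kernel \<sigma> r s) E x)"
proof -
  interpret R: bounded_kernel "truncated_kernel \<sigma> r :: 'a \<Rightarrow> real" "1 / r powr (real DIM('a) + \<sigma>)"
    using assms by (intro truncated_kernel_bounded)
  interpret S: bounded_kernel "truncated_kernel \<sigma> s :: 'a \<Rightarrow> real" "1 / s powr (real DIM('a) + \<sigma>)"
    using assms by (intro truncated_kernel_bounded) auto
  interpret A: integrable_kernel "annular_kernel \<sigma> r s :: 'a \<Rightarrow> real" "1 / r powr (real DIM('a) + \<sigma>)"
    using assms by (intro annular_kernel_integrable)
  have "truncated_kernel \<sigma> r h = truncated_kernel \<sigma> s h + annular_kernel \<sigma> r s h" for h :: 'a
    using assms by (auto simp: truncated_kernel_def annular_kernel_def split: split_indicator)
  then have split: "conv (truncated_kernel \<sigma> r) E x =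
      conv (truncated_kernel \<sigma> s) E x + conv (annular_kernel \<sigma> r s) E x" for x
    unfolding conv_def
    by (simp add: set_integral_add(2)[OF S.section_integrable[OF E] A.section_integrable[OF E]])
  have const: "set_integrable lebesgue E (\<lambda>_. c)" "(LINT x:E|lebesgue. c) = c * measure lebesgue E"
    for c :: real
    using E by (auto simp: set_integrable_def set_lebesgue_integral_def fmeasurable_def mult.commute)
  have "(LINT x:E|lebesgue. c - conv (annular_kernel \<sigma> r s) E x) =
      c * measure lebesgue E - (LINT x:E|lebesgue. conv (annular_kernel \<sigma> r s) E x)" for c
    by (simp add: set_integral_diff(2)[OF const(1) A.conv_integrable[OF E E]] const(2))
  then show ?thesis
    unfolding Jhat_r_eq_conv split
    by (simp add: set_integral_add(2)[OF S.conv_integrable[OF E E] A.conv_integrable[OF E E]]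
      left_diff_distrib)
qed

text \<open>The integrand in \<open>Jhat_r_diff\<close> is nonnegative, because no set captures more
  than the whole mass of the annular kernel.\<close>

lemma Jhat_r_antimono:
  assumes "0 < r" "r \<le> s" "0 \<le> \<sigma>" and E: "E \<in> lmeasurable"
  shows "Jhat_r \<sigma> s E \<le> Jhat_r \<sigma> r (E :: 'a::euclidean_space set)"
proof -
  interpret A: integrable_kernel "annular_kernel \<sigma> r s :: 'a \<Rightarrow> real" "1 / r powr (real DIM('a) + \<sigma>)"
    using assms by (intro annular_kernel_integrable)
  have "0 \<le> Jhat_r \<sigma> r E - Jhat_r \<sigma> s E"
    unfolding Jhat_r_diff[OF assms] set_lebesgue_integral_def
    using A.conv_le_integral[of E] E integral_annular_kernel[OF assms(1,2), where 'a='a]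
    by (intro integral_nonneg_AE AE_I2) auto
  then show ?thesis by simp
qed

text \<open>At cutoff \<open>1\<close> the constant \<open>gamma_const\<close> vanishes and the
  kernel is at most \<open>1\<close>, so the double integral is at most
  \<open>|E|\<^sup>2\<close>.\<close>

lemma Jhat_r_one_ge:
  assumes "0 \<le> \<sigma>" and E: "E \<in> lmeasurable"
  shows "- (measure lebesgue E)\<^sup>2 \<le> Jhat_r \<sigma> 1 (E :: 'a::euclidean_space set)"
proof -
  interpret bounded_kernel "truncated_kernel \<sigma> 1 :: 'a \<Rightarrow> real" 1
    using truncated_kernel_bounded[of 1 \<sigma>, where 'a='a] assms by simp
  have "(LINT x:E|lebesgue. conv (truncated_kernel \<sigma> 1) E x) \<le> (LINT x:E|lebesgue. measure lebesgue E)"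
    using conv_le_measure[OF E] E
    by (intro set_integral_mono conv_integrable) (auto simp: set_integrable_def fmeasurable_def)
  also have "\<dots> = (measure lebesgue E)\<^sup>2"
    using E by (simp add: set_lebesgue_integral_def fmeasurableD power2_eq_square)
  moreover have "gamma_const TYPE('a) \<sigma> 1 = 0" by (simp add: gamma_const_def)
  ultimately show ?thesis by (simp add: Jhat_r_eq_conv)
qed

text \<open>This removes the dependence on \<open>\<sigma>\<close>. The deficit for exponent
  \<open>d + \<sigma>\<close> integrates to
  \<open>Jhat_r \<sigma> \<delta> E - Jhat_r \<sigma> 1 E\<close>, and it dominates pointwise the
  deficit for exponent \<open>d\<close>.\<close>

lemma conv_deficit_le:
  assumes "0 < \<delta>" "\<delta> \<le> 1" "0 \<le> \<sigma>" and E: "E \<in> lmeasurable" and J: "Jhat_r \<sigma> \<delta> E \<le> C"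
  shows "(LINT x:E|lebesgue. - gamma_const TYPE('a) 0 \<delta> - conv (annular_kernel 0 \<delta> 1) E x)
    \<le> C + (measure lebesgue (E :: 'a::euclidean_space set))\<^sup>2"
proof -
  interpret S: integrable_kernel "annular_kernel \<sigma> \<delta> 1 :: 'a \<Rightarrow> real" "1 / \<delta> powr (real DIM('a) + \<sigma>)"
    using assms by (intro annular_kernel_integrable)
  interpret Z: integrable_kernel "annular_kernel 0 \<delta> 1 :: 'a \<Rightarrow> real" "1 / \<delta> powr (real DIM('a) + 0)"
    using assms by (intro annular_kernel_integrable) auto
  \<comment> \<open>Since \<open>\<sigma> \<ge> 0\<close> and \<open>|h| < 1\<close> on the annulus,
    this difference is again a nonnegative even kernel. That its convolution with \<open>E\<close>
    is at most its mass is precisely the comparison of the two deficits.\<close>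
  let ?k = "\<lambda>h::'a. annular_kernel \<sigma> \<delta> 1 h - annular_kernel 0 \<delta> 1 h"
  interpret D: integrable_kernel ?k "1 / \<delta> powr (real DIM('a) + \<sigma>)"
  proof
    show "0 \<le> ?k h" for h
      using assms by (auto simp: annular_kernel_def zero_less_mult_iff split: split_indicator
        intro!: divide_left_mono powr_mono')
    show "?k h \<le> 1 / \<delta> powr (real DIM('a) + \<sigma>)" for h
      using S.kernel_le[of h] Z.kernel_nonneg[of h] by linarith
  qed (auto simp: S.kernel_even Z.kernel_even S.kernel_integrable Z.kernel_integrable)
  have one: "gamma_const TYPE('a) \<sigma> 1 = 0" for \<sigma> by (simp add: gamma_const_def)
  have le: "- gamma_const TYPE('a) 0 \<delta> - conv (annular_kernel 0 \<delta> 1) E x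
      \<le> - gamma_const TYPE('a) \<sigma> \<delta> - conv (annular_kernel \<sigma> \<delta> 1) E x" for x
  proof -
    have "conv (annular_kernel \<sigma> \<delta> 1) E x - conv (annular_kernel 0 \<delta> 1) E x = conv ?k E x"
      unfolding conv_def by (rule set_integral_diff(2)[OF S.section_integrable[OF E]
            Z.section_integrable[OF E], symmetric])
    also have "\<dots> \<le> integral\<^sup>L lborel ?k" using E by (intro D.conv_le_integral) auto
    also have "\<dots> = - gamma_const TYPE('a) \<sigma> \<delta> + gamma_const TYPE('a) 0 \<delta>"
      using integral_annular_kernel[OF assms(1,2), where 'a='a] S.kernel_integrable Z.kernel_integrable
      by (simp add: one)
    finally show ?thesis by simp
  qed
  have const: "set_integrable lebesgue E (\<lambda>_. c)" for c :: real
    using E by (auto simp: set_integrable_def fmeasurable_def)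
  have "(LINT x:E|lebesgue. - gamma_const TYPE('a) 0 \<delta> - conv (annular_kernel 0 \<delta> 1) E x)
     \<le> (LINT x:E|lebesgue. - gamma_const TYPE('a) \<sigma> \<delta> - conv (annular_kernel \<sigma> \<delta> 1) E x)"
    by (intro set_integral_mono set_integral_diff(1) const S.conv_integrable Z.conv_integrable E le)
  also have "\<dots> = Jhat_r \<sigma> \<delta> E - Jhat_r \<sigma> 1 E"
    using Jhat_r_diff[OF assms(1-4)] by (simp add: one)
  also have "\<dots> \<le> C + (measure lebesgue E)\<^sup>2"
    using J Jhat_r_one_ge[OF assms(3,4)] by simp
  finally show ?thesis .
qed

text \<open>By monotonicity the limit at \<open>0\<close> is the supremum over all cutoffs, so it
  bounds the value at each of them.\<close>

lemma Jhat_r_le_Jhat: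
  assumes "0 \<le> \<sigma>" "E \<in> lmeasurable" "0 < r"
  shows "ereal (Jhat_r \<sigma> r E) \<le> Jhat \<sigma> (E :: 'a::euclidean_space set)"
proof -
  let ?S = "SUP s\<in>{0<..}. ereal (Jhat_r \<sigma> s E)"
  have "((\<lambda>r. ereal (Jhat_r \<sigma> r E)) \<longlongrightarrow> ?S) (at_right 0)"
  proof (rule increasing_tendsto)
    show "\<forall>\<^sub>F s in at_right 0. ereal (Jhat_r \<sigma> s E) \<le> ?S"
      using eventually_at_right_less[of "0::real"]
      by eventually_elim (auto intro: SUP_upper)
    fix x assume "x < ?S"
    then obtain t where t: "0 < t" "x < ereal (Jhat_r \<sigma> t E)" by (auto simp: less_SUP_iff)
    show "\<forall>\<^sub>F s in at_right 0. x < ereal (Jhat_r \<sigma> s E)"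
      using eventually_at_right_real[OF t(1)]
    proof eventually_elim
      case (elim s)
      then have "Jhat_r \<sigma> t E \<le> Jhat_r \<sigma> s E"
        using assms by (intro Jhat_r_antimono) auto
      then show ?case using t(2) by (simp add: less_le_trans)
    qed
  qed
  then have "Jhat \<sigma> E = ?S" unfolding Jhat_def by (intro tendsto_Lim) auto
  then show ?thesis using assms(3) by (auto intro: SUP_upper)
qed

section \<open>Compactness\<close>

text \<open>On \<open>E - F\<close> the mass \<open>L\<close> is split as
  \<open>(L - conv k E) + (conv k E - conv k F) + conv k F\<close>. The first term is controlled by
  the deficit of \<open>E\<close>, the second by the distance of the averages and the third, after
  Fubini, by the deficit of \<open>F\<close>. A large \<open>L\<close> then forces
  \<open>E - F\<close> to be small.\<close>

lemma (in integrable_kernel) measure_diff_le: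
  assumes E: "E \<in> lmeasurable" and F: "F \<in> lmeasurable" and U: "U \<in> lmeasurable" and EU: "E \<subseteq> U"
  defines "L \<equiv> integral\<^sup>L lborel k"
  shows "L * measure lebesgue (E - F) \<le> (LINT x:E|lebesgue. L - conv k E x)
    + (LINT x:F|lebesgue. L - conv k F x) + (LINT x:U|lebesgue. \<bar>conv k E x - conv k F x\<bar>)"
proof -
  have A: "E - F \<in> lmeasurable" using E F by auto
  have const: "set_integrable lebesgue A (\<lambda>_. c)" if "A \<in> lmeasurable" for c :: real and A :: "'a set"
    using that by (auto simp: set_integrable_def fmeasurable_def)
  have diff: "set_integrable lebesgue A (\<lambda>x. conv k E x - conv k F x)" if "A \<in> lmeasurable" for A
    using conv_integrable E F that by (intro set_integral_diff(1)) auto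
  have def_int: "set_integrable lebesgue A (\<lambda>x. L - conv k B x)"
    if "A \<in> lmeasurable" "B \<in> lmeasurable" for A B
    using that by (intro set_integral_diff(1) const conv_integrable)
  have "L * measure lebesgue (E - F) = (LINT x:E-F|lebesgue. L)"
    using A by (simp add: set_lebesgue_integral_def fmeasurableD mult.commute)
  also have "\<dots> = (LINT x:E-F|lebesgue. (L - conv k E x) + ((conv k E x - conv k F x) + conv k F x))"
    by simp
  also have "\<dots> = (LINT x:E-F|lebesgue. L - conv k E x)
      + ((LINT x:E-F|lebesgue. conv k E x - conv k F x) + (LINT x:E-F|lebesgue. conv k F x))"
    using A E F
    by (simp only: set_integral_add(2) set_integral_add(1) def_int diff conv_integrable)
  also have "\<dots> \<le> (LINT x:E|lebesgue. L - conv k E x)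
      + ((LINT x:U|lebesgue. \<bar>conv k E x - conv k F x\<bar>) + (LINT x:F|lebesgue. L - conv k F x))"
  proof (intro add_mono)
    show "(LINT x:E-F|lebesgue. L - conv k E x) \<le> (LINT x:E|lebesgue. L - conv k E x)"
      unfolding set_lebesgue_integral_def
      using def_int[OF A E] def_int[OF E E] conv_le_integral[of E] E
      by (intro integral_mono) (auto simp: set_integrable_def L_def split: split_indicator)
    show "(LINT x:E-F|lebesgue. conv k E x - conv k F x)
        \<le> (LINT x:U|lebesgue. \<bar>conv k E x - conv k F x\<bar>)"
      unfolding set_lebesgue_integral_def
      using diff[OF A] set_integrable_abs[OF diff[OF U]] EU
      by (intro integral_mono) (auto simp: set_integrable_def split: split_indicator)
    \<comment> \<open>\<open>E - F\<close> and \<open>F\<close> are disjoint, so together they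
      capture at most the whole mass \<open>L\<close>.\<close>
    have le: "conv k (E - F) x \<le> L - conv k F x" for x
    proof -
      have "conv k (E - F) x + conv k F x = conv k ((E - F) \<union> F) x"
        by (rule conv_union[OF A F, symmetric]) auto
      also have "\<dots> \<le> L"
        unfolding L_def by (rule conv_le_integral[OF sets.Un[OF fmeasurableD[OF A] fmeasurableD[OF F]]])
      finally show ?thesis by simp
    qed
    \<comment> \<open>The bound just proved concerns \<open>conv k (E - F)\<close> on
      \<open>F\<close>, so the double integral is first read in the other order.\<close>
    have "(LINT x:E-F|lebesgue. conv k F x) = (LINT x:F|lebesgue. conv k (E - F) x)"
      by (rule conv_swap[OF A F kernel_even])
    also have "\<dots> \<le> (LINT x:F|lebesgue. L - conv k F x)"
      by (intro set_integral_mono conv_integrable def_int A F le)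
    finally show "(LINT x:E-F|lebesgue. conv k F x) \<le> (LINT x:F|lebesgue. L - conv k F x)" .
  qed
  finally show ?thesis by simp
qed

section \<open>Equicontinuity and convergence of the averages\<close>

text \<open>The right-hand side does not involve \<open>B\<close>, so the averages of all sets share
  one modulus of continuity.\<close>

lemma (in integrable_kernel) conv_dist_le:
  assumes "B \<in> sets lebesgue"
  shows "\<bar>conv k B x - conv k B z\<bar> \<le> (LINT y|lebesgue. \<bar>k (x - y) - k (z - y)\<bar>)"
proof -
  have int: "set_integrable lebesgue B (\<lambda>y. k (w - y))" for w
    unfolding set_integrable_def by (intro integrable_mult_indicator translate_integrable assms)
  have "conv k B x - conv k B z = (LINT y:B|lebesgue. k (x - y) - k (z - y))"
    unfolding conv_def by (rule set_integral_diff(2)[OF int int, symmetric])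
  also have "\<bar>\<dots>\<bar> \<le> (LINT y|lebesgue. \<bar>indicat_real B y *\<^sub>R (k (x - y) - k (z - y))\<bar>)"
    unfolding set_lebesgue_integral_def by (rule integral_abs_bound)
  also have "\<dots> \<le> (LINT y|lebesgue. \<bar>k (x - y) - k (z - y)\<bar>)"
    using assms
    by (intro integral_mono integrable_abs integrable_mult_indicator Bochner_Integration.integrable_diff
        translate_integrable) (auto split: split_indicator)
  finally show ?thesis .
qed

text \<open>Continuity of translation in \<open>L\<^sup>1\<close>, by dominated convergence: the
  kernel is continuous off the spheres \<open>|h| = r\<close> and \<open>|h| = s\<close>, which are
  null.\<close>

lemma annular_kernel_translation_tendsto:
  fixes z :: "nat \<Rightarrow> 'a::euclidean_space"
  assumes "0 < r" "r \<le> s" "0 \<le> \<sigma>" and z: "z \<longlonglongrightarrow> x"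
  shows "(\<lambda>j. LINT y|lebesgue. \<bar>annular_kernel \<sigma> r s (x - y) - annular_kernel \<sigma> r s (z j - y)\<bar>)
    \<longlonglongrightarrow> 0"
proof -
  let ?k = "annular_kernel \<sigma> r s :: 'a \<Rightarrow> real"
  define M where "M = 1 / r powr (real DIM('a) + \<sigma>)"
  interpret integrable_kernel ?k M
    unfolding M_def using assms by (intro annular_kernel_integrable)
  obtain B where B: "norm (z j) \<le> B" for j
    using convergent_imp_Bseq[of z] z by (auto simp: convergent_def Bseq_def)
  have Bx: "norm x \<le> B"
    using tendsto_norm[OF z] B by (intro LIMSEQ_le_const2) auto
  have null: "AE y in lebesgue. y \<notin> sphere x t" for t
    using negligible_sphere[of x t] by (intro AE_not_in) (simp add: negligible_iff_null_sets)
  have pointwise: "(\<lambda>j. ?k (z j - y)) \<longlonglongrightarrow> ?k (x - y)" if y: "norm (x - y) \<noteq> r" "norm (x - y) \<noteq> s" for y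
  proof -
    have lim: "(\<lambda>j. norm (z j - y)) \<longlonglongrightarrow> norm (x - y)"
      by (intro tendsto_intros z)
    consider "norm (x - y) < r" | "s < norm (x - y)" | "r < norm (x - y)" "norm (x - y) < s"
      using y by linarith
    then show ?thesis
    proof cases
      case 1
      then show ?thesis
        by (intro tendsto_eventually eventually_mono[OF order_tendstoD(2)[OF lim 1]])
          (simp add: annular_kernel_def)
    next
      case 2
      then show ?thesis
        by (intro tendsto_eventually eventually_mono[OF order_tendstoD(1)[OF lim 2]])
          (simp add: annular_kernel_def)
    next
      case 3
      have "(\<lambda>j. 1 / norm (z j - y) powr (real DIM('a) + \<sigma>))
          \<longlonglongrightarrow> 1 / norm (x - y) powr (real DIM('a) + \<sigma>)"
        using 3 assms(1) by (intro tendsto_intros lim) auto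
      moreover have "\<forall>\<^sub>F j in sequentially. 1 / norm (z j - y) powr (real DIM('a) + \<sigma>) = ?k (z j - y)"
        using order_tendstoD(1)[OF lim 3(1)] order_tendstoD(2)[OF lim 3(2)]
        by eventually_elim (simp add: annular_kernel_def)
      ultimately show ?thesis
        using 3 by (auto simp: annular_kernel_def elim: Lim_transform_eventually)
    qed
  qed
  have "(\<lambda>j. LINT y|lebesgue. \<bar>?k (x - y) - ?k (z j - y)\<bar>) \<longlonglongrightarrow> (LINT y|(lebesgue :: 'a measure). 0)"
  proof (rule integral_dominated_convergence)
    show "integrable lebesgue (\<lambda>y. M * indicat_real (cball 0 (B + s)) (y::'a))"
      by (intro integrable_mult_right integrable_real_indicator)
        (use emeasure_lborel_cball_finite[of "0::'a" "B + s"] in auto)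
    show "(\<lambda>y. \<bar>?k (x - y) - ?k (z j - y)\<bar>) \<in> borel_measurable lebesgue" for j
      using translate_integrable by (intro borel_measurable_abs borel_measurable_diff) auto
    show "AE y in lebesgue. (\<lambda>j. \<bar>?k (x - y) - ?k (z j - y)\<bar>) \<longlonglongrightarrow> 0"
      using null[of r] null[of s]
    proof eventually_elim
      case (elim y)
      then have "(\<lambda>j. ?k (x - y) - ?k (z j - y)) \<longlonglongrightarrow> ?k (x - y) - ?k (x - y)"
        by (intro tendsto_diff tendsto_const pointwise) (auto simp: dist_norm)
      then show ?case by (intro tendsto_rabs_zero) simp
    qed
    \<comment> \<open>If \<open>|w| \<le> B\<close> and \<open>|y| > B + s\<close> then
      \<open>|w - y| > s\<close>, so all the translates vanish outside one common ball.\<close>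
    have supp: "?k (w - y) = 0" if "norm w \<le> B" "y \<notin> cball 0 (B + s)" for w y
      using norm_triangle_ineq2[of y w] that by (auto simp: annular_kernel_def norm_minus_commute)
    have "\<bar>?k a - ?k b\<bar> \<le> M" for a b
      using kernel_nonneg[of a] kernel_nonneg[of b] kernel_le[of a] kernel_le[of b] by linarith
    then show "AE y in lebesgue. norm \<bar>?k (x - y) - ?k (z j - y)\<bar> \<le> M * indicat_real (cball 0 (B + s)) y"
      for j using supp[OF Bx] supp[OF B[of j]] by (intro AE_I2) (simp split: split_indicator)
  qed simp
  then show ?thesis by simp
qed

text \<open>An argument with three thirds of \<open>e\<close>: the modulus of continuity common to
  all \<open>E n\<close> carries the Cauchy property from a nearby point of \<open>D\<close> to
  \<open>x\<close>.\<close>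

lemma annular_conv_convergent:
  fixes E :: "nat \<Rightarrow> 'a::euclidean_space set"
  assumes "0 < r" "r \<le> s" "0 \<le> \<sigma>" and E: "\<And>n. E n \<in> sets lebesgue"
    and D: "closure D = UNIV"
    and conv: "\<And>z. z \<in> D \<Longrightarrow> convergent (\<lambda>n. conv (annular_kernel \<sigma> r s) (E n) z)"
  shows "convergent (\<lambda>n. conv (annular_kernel \<sigma> r s) (E n) x)"
proof (rule Cauchy_convergent, rule metric_CauchyI)
  fix e :: real assume e: "0 < e"
  let ?k = "annular_kernel \<sigma> r s :: 'a \<Rightarrow> real"
  interpret integrable_kernel ?k "1 / r powr (real DIM('a) + \<sigma>)"
    using assms by (intro annular_kernel_integrable)
  have "x \<in> closure D" using D by simp
  then obtain z where z: "\<And>j. z j \<in> D" "z \<longlonglongrightarrow> x" unfolding closure_sequential by auto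
  have "\<forall>\<^sub>F j in sequentially. (LINT y|lebesgue. \<bar>?k (x - y) - ?k (z j - y)\<bar>) < e / 3"
    by (rule order_tendstoD(2)[OF annular_kernel_translation_tendsto[OF assms(1-3) z(2)]]) (use e in simp)
  then obtain j where j: "(LINT y|lebesgue. \<bar>?k (x - y) - ?k (z j - y)\<bar>) < e / 3"
    by (meson eventually_happens trivial_limit_sequentially)
  have close: "\<bar>conv ?k (E n) x - conv ?k (E n) (z j)\<bar> < e / 3" for n
    using conv_dist_le[OF E[of n], of x "z j"] j by linarith
  have "Cauchy (\<lambda>n. conv ?k (E n) (z j))" using conv[OF z(1)] by (rule convergent_Cauchy)
  then obtain N where N: "\<And>m n. N \<le> m \<Longrightarrow> N \<le> n \<Longrightarrow>
      dist (conv ?k (E m) (z j)) (conv ?k (E n) (z j)) < e / 3"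
    using e by (meson metric_CauchyD divide_pos_pos zero_less_numeral)
  have "dist (conv ?k (E m) x) (conv ?k (E n) x) < e" if "N \<le> m" "N \<le> n" for m n
    using N[OF that] close[of m] close[of n] unfolding dist_real_def by linarith
  then show "\<exists>N. \<forall>m\<ge>N. \<forall>n\<ge>N. dist (conv ?k (E m) x) (conv ?k (E n) x) < e" by blast
qed

text \<open>Were the claim false, two index sequences tending to infinity would keep the integrals
  at least \<open>e\<close>. Along them the integrands tend to \<open>0\<close> pointwise and are
  dominated by the mass of \<open>k\<close> times the indicator of \<open>U\<close>.\<close>

lemma (in integrable_kernel) conv_Cauchy_L1:
  assumes E: "\<And>n. E n \<in> lmeasurable" and U: "U \<in> lmeasurable"
    and conv: "\<And>x. convergent (\<lambda>n::nat. conv k (E n) x)" and e: "0 < e"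
  shows "\<exists>N. \<forall>m\<ge>N. \<forall>n\<ge>N. (LINT x:U|lebesgue. \<bar>conv k (E m) x - conv k (E n) x\<bar>) < e"
proof (rule ccontr)
  assume "\<not> ?thesis"
  then have "\<forall>N. \<exists>m n. N \<le> m \<and> N \<le> n \<and> e \<le> (LINT x:U|lebesgue. \<bar>conv k (E m) x - conv k (E n) x\<bar>)"
    by (meson not_le)
  then obtain m n where mn: "\<And>N. N \<le> m N" "\<And>N. N \<le> n N"
    "\<And>N. e \<le> (LINT x:U|lebesgue. \<bar>conv k (E (m N)) x - conv k (E (n N)) x\<bar>)"
    by metis
  define L where "L = integral\<^sup>L lborel k"
  have lim: "filterlim m sequentially sequentially" "filterlim n sequentially sequentially"
    using mn(1,2) by (auto intro!: filterlim_at_top_mono[OF filterlim_ident])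
  have diff: "set_integrable lebesgue U (\<lambda>x. \<bar>conv k (E i) x - conv k (E j) x\<bar>)" for i j
    using E U by (intro set_integrable_abs set_integral_diff(1) conv_integrable)
  have "(\<lambda>N. LINT x|lebesgue. indicat_real U x *\<^sub>R \<bar>conv k (E (m N)) x - conv k (E (n N)) x\<bar>)
      \<longlonglongrightarrow> (LINT x|(lebesgue :: 'a measure). 0)"
  proof (rule integral_dominated_convergence)
    show "integrable lebesgue (\<lambda>x. L * indicat_real U x)"
      using U by (intro integrable_mult_right integrable_real_indicator) (auto simp: fmeasurable_def)
    show "(\<lambda>x. indicat_real U x *\<^sub>R \<bar>conv k (E (m N)) x - conv k (E (n N)) x\<bar>)
        \<in> borel_measurable lebesgue" for N
      using diff unfolding set_integrable_def by (rule borel_measurable_integrable)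
    show "AE x in lebesgue. norm (indicat_real U x *\<^sub>R \<bar>conv k (E (m N)) x - conv k (E (n N)) x\<bar>)
        \<le> L * indicat_real U x" for N
    proof (intro AE_I2)
      fix x
      have "conv k (E i) x \<le> L" "0 \<le> conv k (E i) x" for i
        using conv_le_integral[of "E i" x] conv_nonneg E unfolding L_def by auto
      from this[of "m N"] this[of "n N"]
      show "norm (indicat_real U x *\<^sub>R \<bar>conv k (E (m N)) x - conv k (E (n N)) x\<bar>) \<le> L * indicat_real U x"
        by (auto split: split_indicator)
    qed
    show "AE x in lebesgue.
        (\<lambda>N. indicat_real U x *\<^sub>R \<bar>conv k (E (m N)) x - conv k (E (n N)) x\<bar>) \<longlonglongrightarrow> 0"
    proof (intro AE_I2)
      fix x
      obtain l where l: "(\<lambda>n. conv k (E n) x) \<longlonglongrightarrow> l" using conv[of x] by (auto simp: convergent_def)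
      have "(\<lambda>N. conv k (E (m N)) x - conv k (E (n N)) x) \<longlonglongrightarrow> l - l"
        by (intro tendsto_diff filterlim_compose[OF l] lim)
      then have "(\<lambda>N. \<bar>conv k (E (m N)) x - conv k (E (n N)) x\<bar>) \<longlonglongrightarrow> 0"
        by (intro tendsto_rabs_zero) simp
      from tendsto_mult_right_zero[OF this, of "indicat_real U x"]
      show "(\<lambda>N. indicat_real U x *\<^sub>R \<bar>conv k (E (m N)) x - conv k (E (n N)) x\<bar>) \<longlonglongrightarrow> 0" by simp
    qed
  qed simp
  then have "(\<lambda>N. LINT x:U|lebesgue. \<bar>conv k (E (m N)) x - conv k (E (n N)) x\<bar>) \<longlonglongrightarrow> 0"
    by (simp add: set_lebesgue_integral_def)
  from order_tendstoD(2)[OF this e] obtain N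
    where "(LINT x:U|lebesgue. \<bar>conv k (E (m N)) x - conv k (E (n N)) x\<bar>) < e"
    by (meson eventually_happens trivial_limit_sequentially)
  with mn(3)[of N] show False by simp
qed

section \<open>Completeness for sets of finite measure\<close>

text \<open>The completeness proof of \<open>L\<^sup>1\<close> carried out with sets, so that the
  limit is a set. Exchanging \<open>m\<close> and \<open>n\<close> turns the one-sided differences
  of the assumption into symmetric ones, which are summable along a fast subsequence.\<close>

lemma Cauchy_sets_convergent_subseq:
  fixes E :: "nat \<Rightarrow> 'b set"
  assumes E: "\<And>n. E n \<in> fmeasurable M" and U: "U \<in> fmeasurable M" "\<And>n. E n \<subseteq> U"
    and Cauchy: "\<And>e::real. 0 < e \<Longrightarrow> \<exists>N. \<forall>m\<ge>N. \<forall>n\<ge>N. measure M (E m - E n) < e"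
  obtains \<psi> :: "nat \<Rightarrow> nat" and F where "strict_mono \<psi>" "F \<in> fmeasurable M"
    "(\<lambda>k. measure M (sym_diff (E (\<psi> k)) F)) \<longlonglongrightarrow> 0"
proof -
  have "\<exists>N. \<forall>m\<ge>N. \<forall>n\<ge>N. measure M (E m - E n) < (1/2) ^ Suc k" for k :: nat
    by (rule Cauchy) simp
  then obtain N where N: "\<And>k m n. N k \<le> m \<Longrightarrow> N k \<le> n \<Longrightarrow> measure M (E m - E n) < (1/2) ^ Suc k"
    by metis
  \<comment> \<open>Partial sums make \<open>\<psi>\<close> strictly increasing, and both
    \<open>\<psi> k\<close> and \<open>\<psi> (Suc k)\<close> are at least
    \<open>N k\<close>.\<close>
  define \<psi> where "\<psi> k = (\<Sum>i\<le>k. Suc (N i))" for k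
  have \<psi>: "strict_mono \<psi>" by (rule strict_monoI_Suc) (simp add: \<psi>_def)
  have "N k \<le> \<psi> k" "N k \<le> \<psi> (Suc k)" for k
    by (cases k; simp add: \<psi>_def)+
  note N' = N[OF this] N[OF this(2,1)]
  define G where "G k = E (\<psi> k)" for k
  define D where "D k = sym_diff (G k) (G (Suc k))" for k
  \<comment> \<open>The limit inferior of the sets \<open>G k\<close>.\<close>
  define F where "F = (\<Union>n. \<Inter>k\<in>{n..}. G k)"
  have G: "G k \<in> fmeasurable M" "G k \<in> sets M" for k using E by (auto simp: G_def)
  have D: "D k \<in> fmeasurable M" for k
    unfolding D_def using G by auto
  have mD: "measure M (D k) \<le> (1/2) ^ k" for k
  proof -
    have "measure M (D k) \<le> measure M (G k - G (Suc k)) + measure M (G (Suc k) - G k)"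
      unfolding D_def using G by (intro measure_Un_le) auto
    also have "\<dots> \<le> (1/2) ^ Suc k + (1/2) ^ Suc k"
      using N'[of k] unfolding G_def by (intro add_mono) auto
    finally show ?thesis by simp
  qed
  have F: "F \<in> fmeasurable M"
  proof (rule fmeasurableI2[OF U(1)])
    show "F \<subseteq> U" unfolding F_def G_def using U(2) by fastforce
    show "F \<in> sets M" unfolding F_def using G by auto
  qed
  have bound: "measure M (sym_diff (G n) F) \<le> 2 * (1/2) ^ n" for n
  proof -
    \<comment> \<open>A point in no \<open>D j\<close> with \<open>j \<ge> n\<close> never changes
      membership from \<open>G n\<close> on, so it lies in \<open>F\<close> exactly if it lies in
      \<open>G n\<close>.\<close>
    have sub: "sym_diff (G n) F \<subseteq> (\<Union>k. D (k + n))"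
    proof (rule ccontr)
      assume "\<not> ?thesis"
      then obtain x where x: "x \<in> sym_diff (G n) F" "\<And>k. x \<notin> D (k + n)" by auto
      have const: "x \<in> G (k + n) \<longleftrightarrow> x \<in> G n" for k
        by (induction k) (use x(2) in \<open>auto simp: D_def\<close>)
      have const': "x \<in> G k \<longleftrightarrow> x \<in> G n" if "n \<le> k" for k
        using const[of "k - n"] that by simp
      have "x \<in> F \<longleftrightarrow> x \<in> G n"
      proof
        assume "x \<in> F"
        then obtain m where "\<forall>k\<in>{m..}. x \<in> G k" unfolding F_def by blast
        then show "x \<in> G n" using const'[of "max m n"] by simp
      next
        assume "x \<in> G n"
        then have "x \<in> (\<Inter>k\<in>{n..}. G k)" using const' by blast
        then show "x \<in> F" unfolding F_def by blast
      qed
      with x(1) show False by auto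
    qed
    have "emeasure M (sym_diff (G n) F) \<le> emeasure M (\<Union>k. D (k + n))"
      using D by (intro emeasure_mono sub) auto
    also have "\<dots> \<le> (\<Sum>k. emeasure M (D (k + n)))"
      using D by (intro emeasure_subadditive_countably) auto
    also have "\<dots> \<le> (\<Sum>k. ennreal ((1/2) ^ (k + n)))"
      using mD by (intro suminf_le) (auto simp: emeasure_eq_measure2[OF D] intro!: ennreal_leI)
    also have "\<dots> = ennreal (\<Sum>k. (1/2) ^ (k + n))"
      by (intro suminf_ennreal2) (auto intro!: summable_ignore_initial_segment summable_geometric)
    also have "(\<Sum>k. (1/2::real) ^ (k + n)) = 2 * (1/2) ^ n"
      by (simp add: power_add suminf_mult2[symmetric] suminf_geometric summable_geometric)
    finally show ?thesis by (simp add: measure_def enn2real_leI)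
  qed
  have "(\<lambda>n. measure M (sym_diff (G n) F)) \<longlonglongrightarrow> 0"
  proof (rule tendsto_sandwich[where f="\<lambda>_. 0"])
    show "(\<lambda>n. 2 * (1/2::real) ^ n) \<longlonglongrightarrow> 0"
      by (intro tendsto_mult_right_zero LIMSEQ_realpow_zero) (auto simp: divide_less_eq)
    show "\<forall>\<^sub>F n in sequentially. measure M (sym_diff (G n) F) \<le> 2 * (1/2) ^ n"
      using bound by simp
  qed auto
  then show ?thesis using that[OF \<psi> F] by (simp add: G_def)
qed

section \<open>Growth of the kernel mass\<close>

lemma annular_mass_pos:
  assumes "0 < \<delta>" "\<delta> < 1"
  shows "0 < - gamma_const TYPE('a::euclidean_space) 0 \<delta>"
proof -
  have "0 < real DIM('a) * measure lebesgue (ball (0::'a) 1)" by (simp add: content_ball)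
  then have "real DIM('a) * measure lebesgue (ball (0::'a) 1) * ln \<delta> < 0"
    using assms by (intro mult_pos_neg) auto
  then show ?thesis by (simp add: gamma_const_def)
qed

text \<open>The mass is a positive multiple of \<open>ln (k + 2)\<close>: the kernel
  \<open>|h| powr - d\<close> is not integrable at the origin, and compactness rests on this
  divergence.\<close>

lemma annular_mass_at_top:
  "filterlim (\<lambda>k. - gamma_const TYPE('a::euclidean_space) 0 (1 / real (k + 2))) at_top sequentially"
proof -
  have "0 < real DIM('a) * measure lebesgue (ball (0::'a) 1)" by (simp add: content_ball)
  moreover have "filterlim (\<lambda>k. ln (real (k + 2))) at_top sequentially"
    by (intro filterlim_compose[OF ln_at_top] filterlim_compose[OF filterlim_real_sequentially]
        filterlim_add_const_nat_at_top)
  ultimately have "filterlim (\<lambda>k. (real DIM('a) * measure lebesgue (ball (0::'a) 1)) * ln (real (k + 2)))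
      at_top sequentially"
    by (intro filterlim_tendsto_pos_mult_at_top[OF tendsto_const])
  then show ?thesis by (simp add: gamma_const_def ln_div)
qed

text \<open>The bound on \<open>Jhat_r\<close> is asked for at a fixed cutoff and all large
  \<open>n\<close>, a form that follows both from the bounds at radii \<open>r n\<close> tending to
  \<open>0\<close> and from those on \<open>Jhat\<close>.\<close>

lemma compactness_of_eventual_bound:
  fixes E :: "nat \<Rightarrow> 'a::euclidean_space set"
  assumes \<sigma>: "\<And>n. 0 \<le> \<sigma> n" and U: "U \<in> lmeasurable"
    and E: "\<And>n. E n \<in> lmeasurable" "\<And>n. E n \<subseteq> U"
    and J: "\<And>\<delta>. 0 < \<delta> \<Longrightarrow> \<delta> < 1 \<Longrightarrow> \<forall>\<^sub>F n in sequentially. Jhat_r (\<sigma> n) \<delta> (E n) \<le> C"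
  shows "\<exists>\<phi> F. strict_mono \<phi> \<and> F \<in> lmeasurable \<and>
    (\<lambda>k::nat. LINT x|lebesgue. \<bar>indicat_real (E (\<phi> k)) x - indicat_real F x\<bar>) \<longlonglongrightarrow> 0"
proof -
  \<comment> \<open>The shift by \<open>2\<close> keeps \<open>\<delta> k\<close> below
    \<open>1\<close>, so that the mass \<open>L k\<close> is positive and can be divided by.\<close>
  define \<delta> where "\<delta> k = 1 / real (k + 2)" for k :: nat
  have \<delta>: "0 < \<delta> k" "\<delta> k < 1" for k by (auto simp: \<delta>_def)
  define \<eta> where "\<eta> k = (annular_kernel 0 (\<delta> k) 1 :: 'a \<Rightarrow> real)" for k
  define L where "L k = - gamma_const TYPE('a) 0 (\<delta> k)" for k
  have \<eta>: "integrable_kernel (\<eta> k) (1 / \<delta> k powr (real DIM('a) + 0))" for k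
    unfolding \<eta>_def using \<delta>[of k] by (intro annular_kernel_integrable) auto
  have L: "integral\<^sup>L lborel (\<eta> k) = L k" for k
    unfolding \<eta>_def L_def using \<delta>[of k]
    by (subst integral_annular_kernel) (auto simp: gamma_const_def)
  have Lpos: "0 < L k" for k unfolding L_def using \<delta> by (rule annular_mass_pos)
  obtain D :: "'a set" where D: "countable D" "closure D = UNIV"
  proof -
    obtain D :: "'a set" where D: "countable D" "\<And>X. open X \<Longrightarrow> X \<noteq> {} \<Longrightarrow> \<exists>d\<in>D. d \<in> X"
      by (rule countable_dense_setE) blast
    have "- closure D = {}"
      using D(2)[of "- closure D"] closure_subset[of D] by auto
    with D(1) show ?thesis by (intro that[of D]) auto
  qed
  \<comment> \<open>Division by \<open>L k\<close> bounds the whole family by \<open>1\<close>. As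
    the pairs \<open>(k, x)\<close> with \<open>x\<close> in \<open>D\<close> are countable, one
    diagonal extraction serves all cutoffs and all points of \<open>D\<close>.\<close>
  let ?f = "\<lambda>n (k, x). conv (\<eta> k) (E n) x / L k"
  have bound: "norm (?f n p) \<le> 1" for n p
  proof (cases p)
    case (Pair k x)
    interpret integrable_kernel "\<eta> k" "1 / \<delta> k powr (real DIM('a) + 0)" by (rule \<eta>)
    show ?thesis
      using Pair conv_nonneg[of "E n" x] conv_le_integral[of "E n" x] E(1)[of n] Lpos[of k] L[of k]
      by (simp add: fmeasurableD)
  qed
  obtain \<phi> where \<phi>: "strict_mono \<phi>"
    and conv: "\<And>p. p \<in> (UNIV :: nat set) \<times> D \<Longrightarrow> \<exists>l. (\<lambda>n. ?f (\<phi> n) p) \<longlonglongrightarrow> l"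
  proof (rule function_convergent_subsequence[of "(UNIV :: nat set) \<times> D" ?f 1])
    show "countable ((UNIV :: nat set) \<times> D)" using D(1) by simp
  qed (use bound that in blast)+
  have convD: "convergent (\<lambda>n. conv (\<eta> k) (E (\<phi> n)) x)" if "x \<in> D" for k x
  proof -
    have "convergent (\<lambda>n. conv (\<eta> k) (E (\<phi> n)) x / L k)"
      using conv[of "(k, x)"] that by (simp add: convergent_def)
    then have "convergent (\<lambda>n. L k * (conv (\<eta> k) (E (\<phi> n)) x / L k))"
      by (intro convergent_mult convergent_const)
    then show ?thesis using Lpos[of k] by simp
  qed
  have convx: "convergent (\<lambda>n. conv (\<eta> k) (E (\<phi> n)) x)" for k x
  proof -
    have "convergent (\<lambda>n. conv (annular_kernel 0 (\<delta> k) 1) (E (\<phi> n)) z)" if "z \<in> D" for z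
      using convD[OF that, of k] unfolding \<eta>_def .
    then show ?thesis
      unfolding \<eta>_def
      by (rule annular_conv_convergent[OF \<delta>(1) less_imp_le[OF \<delta>(2)] order_refl
            fmeasurableD[OF E(1)] D(2)])
  qed
  \<comment> \<open>A bound for the deficits that no longer depends on the set, since
    \<open>E n \<subseteq> U\<close>, nor on the cutoff.\<close>
  define B where "B = C + (measure lebesgue U)\<^sup>2"
  have Cauchy: "\<exists>N. \<forall>m\<ge>N. \<forall>n\<ge>N. measure lebesgue (E (\<phi> m) - E (\<phi> n)) < e" if e: "0 < e" for e
  proof -
    have "filterlim L at_top sequentially"
      unfolding L_def[abs_def] \<delta>_def by (rule annular_mass_at_top)
    \<comment> \<open>\<open>2 * B + 1\<close> collects two deficits of at most \<open>B\<close>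
      each and a distance of averages below \<open>1\<close>. The cutoff is fixed before the
      indices, so \<open>N1\<close> and \<open>N2\<close> may depend on \<open>k\<close>.\<close>
    then have "\<forall>\<^sub>F k in sequentially. (2 * B + 1) / e < L k"
      unfolding filterlim_at_top_dense by blast
    then obtain k where k: "(2 * B + 1) / e < L k"
      by (meson eventually_happens trivial_limit_sequentially)
    interpret integrable_kernel "\<eta> k" "1 / \<delta> k powr (real DIM('a) + 0)" by (rule \<eta>)
    obtain N1 where N1: "\<And>m n. N1 \<le> m \<Longrightarrow> N1 \<le> n \<Longrightarrow>
        (LINT x:U|lebesgue. \<bar>conv (\<eta> k) (E (\<phi> m)) x - conv (\<eta> k) (E (\<phi> n)) x\<bar>) < 1"
      using conv_Cauchy_L1[of "\<lambda>n. E (\<phi> n)" U 1] E(1) U convx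
      by (metis zero_less_one)
    obtain N2 where N2: "\<And>n. N2 \<le> n \<Longrightarrow> Jhat_r (\<sigma> n) (\<delta> k) (E n) \<le> C"
      using J[OF \<delta>[of k]] by (auto simp: eventually_sequentially)
    have deficit: "(LINT x:E (\<phi> n)|lebesgue. L k - conv (\<eta> k) (E (\<phi> n)) x) \<le> B" if "N2 \<le> n" for n
    proof -
      \<comment> \<open>\<open>N2\<close> refers to the original sequence;
        \<open>n \<le> \<phi> n\<close> carries it over to the subsequence.\<close>
      have "N2 \<le> \<phi> n" using that seq_suble[OF \<phi>, of n] by simp
      then have "(LINT x:E (\<phi> n)|lebesgue. L k - conv (\<eta> k) (E (\<phi> n)) x)
          \<le> C + (measure lebesgue (E (\<phi> n)))\<^sup>2"
        unfolding L_def \<eta>_def using \<delta>[of k] \<sigma> E N2 by (intro conv_deficit_le[where \<sigma>="\<sigma> (\<phi> n)"]) auto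
      also have "\<dots> \<le> B"
        unfolding B_def using E U by (intro add_left_mono power_mono measure_mono_fmeasurable) auto
      finally show ?thesis .
    qed
    have "measure lebesgue (E (\<phi> m) - E (\<phi> n)) < e" if "max N1 N2 \<le> m" "max N1 N2 \<le> n" for m n
    proof -
      have "L k * measure lebesgue (E (\<phi> m) - E (\<phi> n)) \<le> 2 * B + 1"
        using measure_diff_le[OF E(1)[of "\<phi> m"] E(1)[of "\<phi> n"] U E(2)[of "\<phi> m"]]
          deficit[of m] deficit[of n] N1[of m n] that unfolding L by simp
      also have "\<dots> < L k * e" using k e by (simp add: pos_divide_less_eq)
      finally show ?thesis using Lpos[of k] by simp
    qed
    then show ?thesis by blast
  qed
  obtain \<psi> F where \<psi>: "strict_mono \<psi>" and F: "F \<in> lmeasurable"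
    and lim: "(\<lambda>k. measure lebesgue (sym_diff (E (\<phi> (\<psi> k))) F)) \<longlonglongrightarrow> 0"
    by (rule Cauchy_sets_convergent_subseq[of "\<lambda>n. E (\<phi> n)", OF E(1) U E(2) Cauchy])
  have "(LINT x|lebesgue. \<bar>indicat_real (E n) x - indicat_real F x\<bar>)
      = measure lebesgue (sym_diff (E n) F)" for n
  proof -
    have "(LINT x|lebesgue. \<bar>indicat_real (E n) x - indicat_real F x\<bar>)
        = (LINT x|lebesgue. indicat_real (sym_diff (E n) F) x)"
      by (intro Bochner_Integration.integral_cong) (auto split: split_indicator)
    then show ?thesis using E(1)[of n] F by (simp add: fmeasurableD)
  qed
  with lim have "(\<lambda>k. LINT x|lebesgue. \<bar>indicat_real (E ((\<phi> \<circ> \<psi>) k)) x - indicat_real F x\<bar>) \<longlonglongrightarrow> 0"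
    by simp
  then show ?thesis using strict_mono_o[OF \<phi> \<psi>] F by blast
qed

theorem theorem5p1:
  fixes \<sigma> r :: "nat \<Rightarrow> real"
    and U :: "'a::euclidean_space set"
    and E :: "nat \<Rightarrow> 'a set"
    and C :: real
  assumes "\<And>n. 0 \<le> \<sigma> n \<and> \<sigma> n < 1"
    and "\<And>n. r n > 0"
    and "r \<longlonglongrightarrow> 0"
    and "open U"
    and "bounded U"
    and "\<And>n. E n \<in> lmeasurable"
    and "\<And>n. E n \<subseteq> U"
    and "C > 0"
  shows "((\<forall>n. Jhat_r (\<sigma> n) (r n) (E n) \<le> C) \<longrightarrow>
           (\<exists>\<phi> F. strict_mono \<phi> \<and> F \<in> lmeasurable \<and>
             (\<lambda>k::nat. LINT x|lebesgue. \<bar>indicat_real (E (\<phi> k)) x - indicat_real F x\<bar>) \<longlonglongrightarrow> 0))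
       \<and> ((\<forall>n. Jhat (\<sigma> n) (E n) \<le> ereal C) \<longrightarrow>
           (\<exists>\<phi> F. strict_mono \<phi> \<and> F \<in> lmeasurable \<and>
             (\<lambda>k::nat. LINT x|lebesgue. \<bar>indicat_real (E (\<phi> k)) x - indicat_real F x\<bar>) \<longlonglongrightarrow> 0))"
proof (intro conjI impI)
  have U: "U \<in> lmeasurable" using assms(4,5) by (rule lmeasurable_open[rotated])
  note compact = compactness_of_eventual_bound[where \<sigma>=\<sigma> and C=C, OF _ U assms(6,7)]
  {
    assume J: "\<forall>n. Jhat_r (\<sigma> n) (r n) (E n) \<le> C"
    show "\<exists>\<phi> F. strict_mono \<phi> \<and> F \<in> lmeasurable \<and>
        (\<lambda>k::nat. LINT x|lebesgue. \<bar>indicat_real (E (\<phi> k)) x - indicat_real F x\<bar>) \<longlonglongrightarrow> 0"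
    proof (rule compact)
      fix \<delta> :: real assume "0 < \<delta>"
      \<comment> \<open>Once \<open>r n < \<delta>\<close>, monotonicity in the cutoff transfers the
        bound from \<open>r n\<close> to the fixed \<open>\<delta>\<close>.\<close>
      with assms(3) have "\<forall>\<^sub>F n in sequentially. r n < \<delta>" by (rule order_tendstoD(2))
      then show "\<forall>\<^sub>F n in sequentially. Jhat_r (\<sigma> n) \<delta> (E n) \<le> C"
      proof eventually_elim
        case (elim n)
        then have "Jhat_r (\<sigma> n) \<delta> (E n) \<le> Jhat_r (\<sigma> n) (r n) (E n)"
          using assms(1,2,6) by (intro Jhat_r_antimono) auto
        then show ?case using J by (meson order_trans)
      qed
    qed (use assms(1) in auto)
  next
    assume J: "\<forall>n. Jhat (\<sigma> n) (E n) \<le> ereal C"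
    show "\<exists>\<phi> F. strict_mono \<phi> \<and> F \<in> lmeasurable \<and>
        (\<lambda>k::nat. LINT x|lebesgue. \<bar>indicat_real (E (\<phi> k)) x - indicat_real F x\<bar>) \<longlonglongrightarrow> 0"
    proof (rule compact)
      fix \<delta> :: real assume "0 < \<delta>"
      \<comment> \<open>The limit dominates every cutoff, so here the bound at
        \<open>\<delta>\<close> holds for all \<open>n\<close>.\<close>
      then have "ereal (Jhat_r (\<sigma> n) \<delta> (E n)) \<le> ereal C" for n
        using Jhat_r_le_Jhat[of "\<sigma> n" "E n" \<delta>] assms(1,6) J by (meson order_trans)
      then show "\<forall>\<^sub>F n in sequentially. Jhat_r (\<sigma> n) \<delta> (E n) \<le> C" by simp
    qed (use assms(1) in auto)
  }
qed

end
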